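(* Suppose $(\mathsf P,\mathsf{Opens})$ is a semitopology and $p\in\mathsf P$. Then the following are equivalent: \begin{itemize} \item $p$ is regular. \item $p$ is weakly regular and unconflicted. \end{itemize} More succinctly: regular = weakly regular + unconflicted.
   Context: A semitopology is a pair $(\mathsf P,\mathsf{Opens})$ with $\mathsf{Opens}\subseteq\mathcal P(\mathsf P)$ containing $\varnothing$ and $\mathsf P$ and closed under arbitrary unions. Points $p,p'$ are intertwined when every open neighbourhood of $p$ intersects every open neighbourhood of $p'$; $p_{\between}$ denotes the set of points intertwined with $p$. $\mathrm{interior}(X)$ is the union of open sets contained in $X$. The community of $p$ is $K(p)=\mathrm{interior}(p_{\between})$. $p$ is regular when $p\in K(p)$ and $K(p)$ is nonempty, open and transitive (for all open $O,O'$, if $O\cap K(p)\neq\varnothing$ and $K(p)\cap O'\neq\varnothing$ then $O\cap O'\neq\varnothing$); weakly regular when $p\in K(p)$. $p$ is unconflicted when whenever $p'$ is intertwined with $p$ and $p$ is intertwined with $p''$, also $p'$ is intertwined with $p''$. *)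

theory Defs
  imports Main
begin

definition semitopology :: "'a set \<Rightarrow> 'a set set \<Rightarrow> bool" where
  "semitopology P Opens \<longleftrightarrow>
     Opens \<subseteq> Pow P \<and> {} \<in> Opens \<and> P \<in> Opens \<and> (\<forall>\<U>. \<U> \<subseteq> Opens \<longrightarrow> \<Union>\<U> \<in> Opens)"

text \<open>
  Elements of the ambient type outside the carrier \<open>P\<close> have no open neighbourhoods and so are
  vacuously \<open>intertwined\<close> with everything.  The definitions below that collect or quantify over
  intertwined points therefore restrict them to \<open>P\<close> explicitly.
\<close>

definition intertwined :: "'a set set \<Rightarrow> 'a \<Rightarrow> 'a \<Rightarrow> bool" where
  "intertwined Opens p p' \<longleftrightarrow>
     (\<forall>O1\<in>Opens. \<forall>O2\<in>Opens. p \<in> O1 \<longrightarrow> p' \<in> O2 \<longrightarrow> O1 \<inter> O2 \<noteq> {})"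

definition intertwined_points :: "'a set \<Rightarrow> 'a set set \<Rightarrow> 'a \<Rightarrow> 'a set" where
  "intertwined_points P Opens p = {p' \<in> P. intertwined Opens p p'}"

definition semi_interior :: "'a set set \<Rightarrow> 'a set \<Rightarrow> 'a set" where
  "semi_interior Opens X = \<Union>{U \<in> Opens. U \<subseteq> X}"

definition community :: "'a set \<Rightarrow> 'a set set \<Rightarrow> 'a \<Rightarrow> 'a set" where
  "community P Opens p = semi_interior Opens (intertwined_points P Opens p)"

definition transitive_set :: "'a set set \<Rightarrow> 'a set \<Rightarrow> bool" where
  "transitive_set Opens T \<longleftrightarrow>
     (\<forall>O1\<in>Opens. \<forall>O2\<in>Opens. O1 \<inter> T \<noteq> {} \<longrightarrow> T \<inter> O2 \<noteq> {} \<longrightarrow> O1 \<inter> O2 \<noteq> {})"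

definition regular_point :: "'a set \<Rightarrow> 'a set set \<Rightarrow> 'a \<Rightarrow> bool" where
  "regular_point P Opens p \<longleftrightarrow>
     p \<in> community P Opens p \<and> community P Opens p \<noteq> {} \<and>
     community P Opens p \<in> Opens \<and> transitive_set Opens (community P Opens p)"

definition weakly_regular_point :: "'a set \<Rightarrow> 'a set set \<Rightarrow> 'a \<Rightarrow> bool" where
  "weakly_regular_point P Opens p \<longleftrightarrow> p \<in> community P Opens p"

definition unconflicted :: "'a set \<Rightarrow> 'a set set \<Rightarrow> 'a \<Rightarrow> bool" where
  "unconflicted P Opens p \<longleftrightarrow>
     (\<forall>p'\<in>P. \<forall>p''\<in>P. intertwined Opens p' p \<longrightarrow> intertwined Opens p p'' \<longrightarrow>
        intertwined Opens p' p'')"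

end

theory Submission
  imports Defs
begin

text \<open>Weak regularity already makes the community of \<open>p\<close> an open neighbourhood of
  \<open>p\<close>, so the question is only whether transitivity of the community matches
  \<open>p\<close> being unconflicted. Both let \<open>p\<close> mediate between two open sets:
  \<open>unconflicted_if_mem_open_transitive\<close> uses a transitive neighbourhood as the bridge,
  and \<open>transitive_set_if_unconflicted\<close> uses \<open>p\<close> itself.\<close>

lemma intertwined_sym: "intertwined Opens p p' \<Longrightarrow> intertwined Opens p' p"
  unfolding intertwined_def by (metis inf_commute)

lemma community_open:
  assumes "semitopology P Opens"
  shows "community P Opens p \<in> Opens"
proof -
  have "{U \<in> Opens. U \<subseteq> intertwined_points P Opens p} \<subseteq> Opens" by blast
  with assms show ?thesis
    unfolding semitopology_def community_def semi_interior_def by metis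
qed

lemma community_subset: "community P Opens p \<subseteq> intertwined_points P Opens p"
  unfolding community_def semi_interior_def by blast

text \<open>\<open>T\<close> is an open neighbourhood of \<open>p\<close>, so every neighbourhood of
  a point intertwined with \<open>p\<close> meets \<open>T\<close>; transitivity then makes any two
  such neighbourhoods meet each other.\<close>

lemma unconflicted_if_mem_open_transitive:
  assumes "T \<in> Opens" and "transitive_set Opens T" and "p \<in> T"
  shows "unconflicted P Opens p"
  unfolding unconflicted_def
proof (intro ballI impI)
  fix p' p'' assume left: "intertwined Opens p' p" and right: "intertwined Opens p p''"
  show "intertwined Opens p' p''"
    unfolding intertwined_def
  proof (intro ballI impI)
    fix O1 O2 assume opens: "O1 \<in> Opens" "O2 \<in> Opens" and "p' \<in> O1" "p'' \<in> O2"
    then have "O1 \<inter> T \<noteq> {}" "T \<inter> O2 \<noteq> {}"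
      using left right assms unfolding intertwined_def by simp_all
    with opens assms(2) show "O1 \<inter> O2 \<noteq> {}"
      unfolding transitive_set_def by simp
  qed
qed

text \<open>Points of \<open>T\<close> witnessing that \<open>O1\<close> and \<open>O2\<close> meet
  \<open>T\<close> are both intertwined with \<open>p\<close>, hence with each other, which forces
  \<open>O1\<close> and \<open>O2\<close> to intersect.\<close>

lemma transitive_set_if_unconflicted:
  assumes "unconflicted P Opens p" and "T \<subseteq> intertwined_points P Opens p"
  shows "transitive_set Opens T"
  unfolding transitive_set_def
proof (intro ballI impI)
  fix O1 O2 assume opens: "O1 \<in> Opens" "O2 \<in> Opens" and "O1 \<inter> T \<noteq> {}" "T \<inter> O2 \<noteq> {}"
  then obtain x y where xy: "x \<in> O1" "x \<in> T" "y \<in> T" "y \<in> O2" by blast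
  then have "x \<in> P" "y \<in> P" "intertwined Opens x p" "intertwined Opens p y"
    using assms(2) by (auto simp: intertwined_points_def intro: intertwined_sym)
  then have "intertwined Opens x y"
    using assms(1) unfolding unconflicted_def by simp
  with opens xy show "O1 \<inter> O2 \<noteq> {}"
    unfolding intertwined_def by simp
qed

theorem theorem6p6:
  fixes P :: "'a set" and Opens :: "'a set set" and p :: 'a
  assumes "semitopology P Opens" and "p \<in> P"
  shows "regular_point P Opens p \<longleftrightarrow>
           weakly_regular_point P Opens p \<and> unconflicted P Opens p"
proof
  assume "regular_point P Opens p"
  then show "weakly_regular_point P Opens p \<and> unconflicted P Opens p"
    unfolding regular_point_def weakly_regular_point_def
    by (blast intro: unconflicted_if_mem_open_transitive)
next
  assume "weakly_regular_point P Opens p \<and> unconflicted P Opens p"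
  then show "regular_point P Opens p"
    \<comment> \<open>The community is a union of open sets, hence open, and it is nonempty because
      it contains \<open>p\<close>; being unconflicted supplies transitivity.\<close>
    using community_open[OF assms(1)] transitive_set_if_unconflicted[OF _ community_subset]
    unfolding regular_point_def weakly_regular_point_def by auto
qed

end
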